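(* Let $G$ be a finite graph (loops and multiple edges allowed). If $G$ does not have connected components of nullity $0$, then the coefficients of $\omega_G(\beta)$ are non-negative.
   Context: Graphs are finite undirected multigraphs; loops and multiple edges are allowed. The nullity of a connected graph with vertex set $V$ and edge set $E$ is $|E|-|V|+1$. The degree of a vertex is the number of edge-ends at it (a loop counts twice). For $s\subset E$, $d_i(s)$ is the degree of vertex $i$ in the spanning subgraph $(V,s)$. The polynomials $f_n(x)$, $n\ge 0$, are defined by $f_0(x)=1$, $f_1(x)=0$, $f_{n+1}(x)=x f_n(x)+f_{n-1}(x)$ for $n\ge1$. For $G=(V,E)$ put $\theta_G(\beta,\gamma):=\sum_{s\subset E}\beta^{|s|}\prod_{i\in V}f_{d_i(s)}(\gamma)$ and $$\omega_G(\beta):=\frac{\theta_G(\beta,2\sqrt{-1})}{(1-\beta)^{|E|-|V|}},$$ which is a polynomial in $\mathbb{Z}[\beta]$. *)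

theory Defs
  imports Complex_Main "HOL-Library.Multiset" "HOL-Computational_Algebra.Computational_Algebra"
begin

(* Undirected multigraphs: "ends G e" is the two-element multiset of the end vertices
   of the edge e; a loop at v has ends {#v, v#}. *)

record ('v, 'e) multigraph =
  verts :: "'v set"
  edges :: "'e set"
  ends :: "'e \<Rightarrow> 'v multiset"

locale finite_multigraph =
  fixes G :: "('v, 'e) multigraph"
  assumes finite_verts: "finite (verts G)"
    and finite_edges: "finite (edges G)"
    and size_ends: "e \<in> edges G \<Longrightarrow> size (ends G e) = 2"
    and ends_in_verts: "e \<in> edges G \<Longrightarrow> set_mset (ends G e) \<subseteq> verts G"

definition vertex_degree :: "('v, 'e) multigraph \<Rightarrow> 'v \<Rightarrow> nat" where
  "vertex_degree G i = (\<Sum>e\<in>edges G. count (ends G e) i)"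

definition spanning_subgraph :: "('v, 'e) multigraph \<Rightarrow> 'e set \<Rightarrow> ('v, 'e) multigraph" where
  "spanning_subgraph G s = \<lparr>verts = verts G, edges = s, ends = ends G\<rparr>"

definition induced_subgraph :: "('v, 'e) multigraph \<Rightarrow> 'v set \<Rightarrow> ('v, 'e) multigraph" where
  "induced_subgraph G C =
     \<lparr>verts = C, edges = {e \<in> edges G. set_mset (ends G e) \<subseteq> C}, ends = ends G\<rparr>"

definition adj :: "('v, 'e) multigraph \<Rightarrow> ('v \<times> 'v) set" where
  "adj G = {(u, v). \<exists>e\<in>edges G. ends G e = {#u, v#}}"

definition connected_components :: "('v, 'e) multigraph \<Rightarrow> ('v, 'e) multigraph set" where
  "connected_components G = induced_subgraph G ` (verts G // Restr ((adj G)\<^sup>*) (verts G))"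

definition nullity :: "('v, 'e) multigraph \<Rightarrow> int" where
  "nullity G = int (card (edges G)) - int (card (verts G)) + 1"

fun f_poly :: "nat \<Rightarrow> complex poly" where
  "f_poly 0 = 1"
| "f_poly (Suc 0) = 0"
| "f_poly (Suc (Suc n)) = [:0, 1:] * f_poly (Suc n) + f_poly n"

(* theta G \<gamma> is the polynomial in \<beta>, for a fixed value of \<gamma>. *)
definition theta :: "('v, 'e) multigraph \<Rightarrow> complex \<Rightarrow> complex poly" where
  "theta G \<gamma> = (\<Sum>s\<in>Pow (edges G).
     monom (\<Prod>i\<in>verts G. poly (f_poly (vertex_degree (spanning_subgraph G s) i)) \<gamma>) (card s))"

(* The exponent |E| - |V| may be negative and the quotient is not a polynomial by
   construction, so omega is taken in the field of rational functions in \<beta>;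
   [:1, -1:] is 1 - \<beta>. *)
definition omega :: "('v, 'e) multigraph \<Rightarrow> complex poly fract" where
  "omega G = to_fract (theta G (2 * \<i>)) /
     to_fract [:1, -1:] powi (int (card (edges G)) - int (card (verts G)))"

end

theory Submission
  imports Defs
begin

text \<open>
  At \<open>\<gamma> = 2\<i>\<close> the recursion for \<open>f\<^sub>n\<close> has the double characteristic root \<open>\<i>\<close>, so that
  \<open>f\<^sub>n(2\<i>) = (1 - n) \<i>\<^sup>n\<close>. The degrees in \<open>s\<close> add up to \<open>2|s|\<close>, hence the powers of \<open>\<i>\<close> multiply to
  \<open>(-1)\<^bsup>|s|\<^esup>\<close> and \<open>\<theta>\<close> becomes, with \<open>X\<close> for \<open>\<beta>\<close>, the integer polynomial
  \<open>S(V,E) = \<Sum>s\<subseteq>E. (-X)\<^bsup>|s|\<^esup> \<Prod>i\<in>V. (1 - d\<^sub>i(s))\<close> (lemma \<open>theta_eq_signed_degree_sum\<close>).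

  The sum \<open>S\<close> satisfies linear recursions with non-negative coefficients apart from the factor
  \<open>1 - X\<close> that is divided out in \<open>\<omega>\<close>. For a link \<open>e\<close> between distinct vertices this is
  deletion-contraction, \<open>S(G) = (1 - X) S(G \ e) + X S(G / e)\<close>. For an edge that meets \<open>V\<close> in a
  single vertex \<open>v\<close>, with multiplicity \<open>c\<close>, it reads
  \<open>S(V,E) = (1 - X) S(V,E-e) + c X S(V-v,E-e)\<close>; here the edges at \<open>v\<close> survive the removal of \<open>v\<close>,
  so edges with ends outside the vertex set have to be admitted.

  These recursions may run into trees, whose \<open>\<omega>\<close> is \<open>1 - X\<close>. A certificate that they do not is an
  injection \<open>\<psi>\<close> that gives every vertex an edge of its own incident with it
  (\<open>edge_representatives\<close>): if only edges outside the image of \<open>\<psi>\<close> are removed or contracted,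
  \<open>\<psi>\<close> restricts to the smaller structures. When all edges are in the image, \<open>|E| = |V|\<close>. A vertex of
  degree 1 can then be cut off together with its edge, because the factor \<open>1 - d\<^sub>i(s)\<close> vanishes at
  degree 1; and if there is no such vertex, a count of edge ends shows that all degrees are 2, in
  which case every summand of \<open>S\<close> is 0 or \<open>X\<^bsup>|s|\<^esup>\<close> (\<open>nonneg_coeffs_min_degree_two\<close>). Induction
  on the number of edges gives \<open>S = (1 - X)\<^bsup>|E|-|V|\<^esup> p\<close> with \<open>p\<close> non-negative
  (\<open>signed_degree_sum_nonneg\<close>).

  Such a \<open>\<psi>\<close> exists when no component has nullity 0 (\<open>representatives_of_nullity\<close>): a component
  has an edge outside a spanning tree, and if the tree is rooted at an end of that edge, every other
  vertex can take the edge towards its parent while the root takes the extra edge.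
\<close>

section \<open>Signed degree sums\<close>

definition degree_in :: "('e \<Rightarrow> 'v multiset) \<Rightarrow> 'e set \<Rightarrow> 'v \<Rightarrow> nat" where
  "degree_in g s i = (\<Sum>e\<in>s. count (g e) i)"

text \<open>
  The vertex set is a parameter independent of the ends of the edges, so that shrinking it removes the
  factor of a vertex and leaves the edges there in place as half-edges.
\<close>

definition signed_degree_sum :: "'v set \<Rightarrow> 'e set \<Rightarrow> ('e \<Rightarrow> 'v multiset) \<Rightarrow> int poly" where
  "signed_degree_sum V E g =
     (\<Sum>s\<in>Pow E. (- [:0, 1:]) ^ card s * (\<Prod>i\<in>V. of_int (1 - int (degree_in g s i))))"

lemma degree_in_insert:
  assumes "finite s" "e \<notin> s"
  shows "degree_in g (insert e s) i = count (g e) i + degree_in g s i"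
  using assms by (simp add: degree_in_def)

lemma sum_Pow_insert:
  assumes "finite E" "e \<notin> E"
  shows "(\<Sum>s\<in>Pow (insert e E). f s) = (\<Sum>s\<in>Pow E. f s + (f (insert e s) :: 'a :: comm_monoid_add))"
proof -
  have "inj_on (insert e) (Pow E)"
    using assms(2) by (auto simp: inj_on_def)
  moreover have "Pow E \<inter> insert e ` Pow E = {}"
    using assms(2) by auto
  ultimately show ?thesis
    using assms(1) by (simp add: Pow_insert sum.union_disjoint sum.reindex sum.distrib)
qed

text \<open>
  The common source of the recursions: a set of edges is taken together with its extension by \<open>e\<close>, so
  that each recursion reduces to an identity between the factors at the ends of \<open>e\<close>.
\<close>

lemma signed_degree_sum_insert:
  assumes "finite E" "e \<notin> E"
  shows "signed_degree_sum V (insert e E) g =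
    (\<Sum>s\<in>Pow E. (- [:0, 1:]) ^ card s *
       ((\<Prod>i\<in>V. of_int (1 - int (degree_in g s i)))
        - [:0, 1:] * (\<Prod>i\<in>V. of_int (1 - int (count (g e) i) - int (degree_in g s i)))))"
proof -
  have "finite s" "e \<notin> s" if "s \<in> Pow E" for s
    using that assms finite_subset by auto
  then show ?thesis
    unfolding signed_degree_sum_def sum_Pow_insert[OF assms]
    by (intro sum.cong) (auto simp: degree_in_insert algebra_simps)
qed

lemma signed_degree_sum_insert_disjoint:
  assumes "finite E" "e \<notin> E" "\<And>i. i \<in> V \<Longrightarrow> i \<notin># g e"
  shows "signed_degree_sum V (insert e E) g = [:1, -1:] * signed_degree_sum V E g"
proof -
  have X: "[:1, -1:] = 1 - [:0, 1 :: int:]" by (simp add: one_pCons)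
  have "(\<Prod>i\<in>V. of_int (1 - int (count (g e) i) - int (degree_in g s i)))
      = (\<Prod>i\<in>V. of_int (1 - int (degree_in g s i)) :: int poly)" for s
    by (rule prod.cong) (use assms(3) in \<open>auto simp: not_in_iff\<close>)
  then show ?thesis
    unfolding signed_degree_sum_insert[OF assms(1,2)] unfolding signed_degree_sum_def X sum_distrib_left
    by (intro sum.cong) (auto simp: algebra_simps simp del: pCons_one)
qed

text \<open>
  With \<open>a\<close> the degree of \<open>v\<close> in \<open>s\<close> and \<open>c\<close> the multiplicity of \<open>e\<close> at \<open>v\<close>, the factor at \<open>v\<close> is
  \<open>(1 - a) - X (1 - a - c) = (1 - X) (1 - a) + c X\<close>. This covers half-edges (\<open>c = 1\<close>) and loops
  (\<open>c = 2\<close>).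
\<close>

lemma signed_degree_sum_insert_single:
  assumes "finite E" "e \<notin> E" "finite V" "v \<in> V" "\<And>i. i \<in> V - {v} \<Longrightarrow> i \<notin># g e"
  shows "signed_degree_sum V (insert e E) g =
    [:1, -1:] * signed_degree_sum V E g
    + of_nat (count (g e) v) * [:0, 1:] * signed_degree_sum (V - {v}) E g"
proof -
  have X: "[:1, -1:] = 1 - [:0, 1 :: int:]" by (simp add: one_pCons)
  define Q where "Q s = (\<Prod>i\<in>V - {v}. of_int (1 - int (degree_in g s i)) :: int poly)" for s
  have 1: "(\<Prod>i\<in>V. of_int (1 - int (degree_in g s i))) = of_int (1 - int (degree_in g s v)) * Q s" for s
    unfolding Q_def by (rule prod.remove[OF assms(3,4)])
  have 2: "(\<Prod>i\<in>V. of_int (1 - int (count (g e) i) - int (degree_in g s i)))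
      = of_int (1 - int (count (g e) v) - int (degree_in g s v)) * Q s" for s
  proof -
    have "(\<Prod>i\<in>V - {v}. of_int (1 - int (count (g e) i) - int (degree_in g s i))) = Q s"
      unfolding Q_def by (rule prod.cong) (use assms(5) in \<open>auto simp: not_in_iff\<close>)
    then show ?thesis by (simp only: prod.remove[OF assms(3,4)])
  qed
  show ?thesis
    unfolding signed_degree_sum_insert[OF assms(1,2)] unfolding signed_degree_sum_def 1 2 X
      sum_distrib_left sum.distrib[symmetric] Q_def[symmetric]
    by (intro sum.cong) (auto simp: algebra_simps simp del: pCons_one)
qed

text \<open>
  Sets containing the only edge at \<open>v\<close> contribute nothing, as the factor \<open>1 - 1\<close> at \<open>v\<close> vanishes;
  for the others the factor at \<open>v\<close> is 1.
\<close>

lemma signed_degree_sum_leaf: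
  assumes "finite E" "e \<notin> E" "finite V" "v \<in> V"
    and "count (g e) v = 1" "degree_in g E v = 0"
  shows "signed_degree_sum V (insert e E) g = signed_degree_sum (V - {v}) E g"
proof -
  have d: "degree_in g s v = 0" if "s \<in> Pow E" for s
    using assms(1,6) that unfolding degree_in_def by (intro sum.neutral) auto
  show ?thesis
    unfolding signed_degree_sum_insert[OF assms(1,2)] unfolding signed_degree_sum_def
  proof (rule sum.cong[OF refl])
    fix s assume s: "s \<in> Pow E"
    show "(- [:0, 1:]) ^ card s *
       ((\<Prod>i\<in>V. of_int (1 - int (degree_in g s i)))
        - [:0, 1:] * (\<Prod>i\<in>V. of_int (1 - int (count (g e) i) - int (degree_in g s i)))) =
       (- [:0, 1:]) ^ card s * (\<Prod>i\<in>V - {v}. of_int (1 - int (degree_in g s i)) :: int poly)"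
      unfolding prod.remove[OF assms(3,4)] d[OF s] assms(5) by simp
  qed
qed

definition contract_ends :: "'v \<Rightarrow> 'v \<Rightarrow> ('e \<Rightarrow> 'v multiset) \<Rightarrow> 'e \<Rightarrow> 'v multiset" where
  "contract_ends u v g x = image_mset (\<lambda>i. if i = v then u else i) (g x)"

lemma count_contract_ends:
  assumes "u \<noteq> v" "i \<noteq> v"
  shows "count (contract_ends u v g x) i =
    (if i = u then count (g x) u + count (g x) v else count (g x) i)"
proof -
  have "count (image_mset (\<lambda>i. if i = v then u else i) m) i =
    (if i = u then count m u + count m v else count m i)" for m
    by (induction m) (use assms in auto)
  then show ?thesis by (simp add: contract_ends_def)
qed

lemma degree_in_contract_ends:
  assumes "u \<noteq> v" "i \<noteq> v"
  shows "degree_in (contract_ends u v g) s i =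
    (if i = u then degree_in g s u + degree_in g s v else degree_in g s i)"
  using assms by (simp add: degree_in_def count_contract_ends sum.distrib)

text \<open>
  If \<open>a\<close> and \<open>b\<close> are the degrees of \<open>u\<close> and \<open>v\<close> in \<open>s\<close>, then the merged vertex has degree \<open>a + b\<close>, and
  \<open>(1 - a) (1 - b) - X a b = (1 - X) (1 - a) (1 - b) + X (1 - a - b)\<close>.
\<close>

lemma signed_degree_sum_deletion_contraction:
  assumes "finite E" "e \<notin> E" "finite V" "u \<in> V" "v \<in> V" "u \<noteq> v" "g e = {#u, v#}"
  shows "signed_degree_sum V (insert e E) g =
    [:1, -1:] * signed_degree_sum V E g
    + [:0, 1:] * signed_degree_sum (V - {v}) E (contract_ends u v g)"
proof -
  have X: "[:1, -1:] = 1 - [:0, 1 :: int:]" by (simp add: one_pCons)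
  have uV: "u \<in> V - {v}" and fV: "finite (V - {v})" using assms by auto
  define Q where "Q s = (\<Prod>i\<in>V - {v} - {u}. of_int (1 - int (degree_in g s i)) :: int poly)" for s
  have 1: "(\<Prod>i\<in>V. of_int (1 - int (degree_in g s i))) =
    of_int (1 - int (degree_in g s v)) * (of_int (1 - int (degree_in g s u)) * Q s)" for s
    unfolding Q_def prod.remove[OF assms(3,5)] prod.remove[OF fV uV] ..
  have 2: "(\<Prod>i\<in>V. of_int (1 - int (count (g e) i) - int (degree_in g s i))) =
    of_int (- int (degree_in g s v)) * (of_int (- int (degree_in g s u)) * Q s)" for s
  proof -
    have "(\<Prod>i\<in>V - {v} - {u}. of_int (1 - int (count (g e) i) - int (degree_in g s i))) = Q s"
      unfolding Q_def by (rule prod.cong) (use assms(7) in auto)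
    then show ?thesis
      unfolding prod.remove[OF assms(3,5)] prod.remove[OF fV uV] using assms(6,7) by simp
  qed
  have 3: "(\<Prod>i\<in>V - {v}. of_int (1 - int (degree_in (contract_ends u v g) s i))) =
    of_int (1 - int (degree_in g s u) - int (degree_in g s v)) * Q s" for s
  proof -
    have "(\<Prod>i\<in>V - {v} - {u}. of_int (1 - int (degree_in (contract_ends u v g) s i))) = Q s"
      unfolding Q_def by (rule prod.cong) (use assms(6) in \<open>auto simp: degree_in_contract_ends\<close>)
    then show ?thesis
      unfolding prod.remove[OF fV uV] using assms(6) by (simp add: degree_in_contract_ends algebra_simps)
  qed
  show ?thesis
    unfolding signed_degree_sum_insert[OF assms(1,2)] unfolding signed_degree_sum_def 1 2 3 X
      sum_distrib_left sum.distrib[symmetric]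
    by (intro sum.cong) (auto simp: algebra_simps simp del: pCons_one)
qed

section \<open>Non-negativity in the presence of distinct edge representatives\<close>

definition nonneg_coeffs :: "int poly \<Rightarrow> bool" where
  "nonneg_coeffs p \<longleftrightarrow> (\<forall>k. coeff p k \<ge> 0)"

lemma nonneg_coeffs_add: "nonneg_coeffs p \<Longrightarrow> nonneg_coeffs q \<Longrightarrow> nonneg_coeffs (p + q)"
  by (simp add: nonneg_coeffs_def)

lemma nonneg_coeffs_mult: "nonneg_coeffs p \<Longrightarrow> nonneg_coeffs q \<Longrightarrow> nonneg_coeffs (p * q)"
  by (auto simp: nonneg_coeffs_def coeff_mult intro!: sum_nonneg)

lemma nonneg_coeffs_sum: "(\<And>x. x \<in> A \<Longrightarrow> nonneg_coeffs (f x)) \<Longrightarrow> nonneg_coeffs (\<Sum>x\<in>A. f x)"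
  by (auto simp: nonneg_coeffs_def coeff_sum intro!: sum_nonneg)

lemma nonneg_coeffs_X: "nonneg_coeffs [:0, 1:]"
  by (auto simp: nonneg_coeffs_def coeff_pCons split: nat.split)

lemma nonneg_coeffs_of_nat: "nonneg_coeffs (of_nat n)"
  by (auto simp: nonneg_coeffs_def of_nat_poly coeff_pCons split: nat.split)

lemma nonneg_coeffs_power: "nonneg_coeffs p \<Longrightarrow> nonneg_coeffs (p ^ n)"
  by (induction n) (use nonneg_coeffs_of_nat[of 1] in \<open>auto intro: nonneg_coeffs_mult\<close>)

text \<open>
  A system of distinct representatives for the sets of edges at the vertices of \<open>V\<close>. On an ordinary
  graph it exists exactly when no component is a tree.
\<close>

definition edge_representatives ::
    "'v set \<Rightarrow> 'e set \<Rightarrow> ('e \<Rightarrow> 'v multiset) \<Rightarrow> ('v \<Rightarrow> 'e) \<Rightarrow> bool" where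
  "edge_representatives V E g \<psi> \<longleftrightarrow> inj_on \<psi> V \<and> \<psi> ` V \<subseteq> E \<and> (\<forall>v\<in>V. v \<in># g (\<psi> v))"

lemma edge_representatives_card_le:
  "edge_representatives V E g \<psi> \<Longrightarrow> finite E \<Longrightarrow> card V \<le> card E"
  by (meson card_inj_on_le edge_representatives_def)

lemma sum_eq_bound_imp_eq:
  fixes f :: "'a \<Rightarrow> nat"
  assumes "finite A" "\<And>x. x \<in> A \<Longrightarrow> f x \<le> g x" "sum g A \<le> sum f A" "x \<in> A"
  shows "f x = g x"
proof (rule ccontr)
  assume "f x \<noteq> g x"
  then have "f x < g x" using assms by (metis le_neq_implies_less)
  then have "sum f A < sum g A" using assms by (intro sum_strict_mono_ex1) auto
  then show False using assms by simp
qed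

lemma sum_count_le_size:
  assumes "finite V" shows "(\<Sum>i\<in>V. count m i) \<le> size m"
proof -
  have "(\<Sum>i\<in>V. count m i) \<le> (\<Sum>i\<in>V \<union> set_mset m. count m i)"
    using assms by (intro sum_mono2) auto
  also have "\<dots> = (\<Sum>i\<in>set_mset m. count m i)"
    using assms by (intro sum.mono_neutral_right) (auto simp: not_in_iff)
  finally show ?thesis by (simp add: size_multiset_overloaded_eq)
qed

lemma sum_degree_in: "(\<Sum>i\<in>V. degree_in g s i) = (\<Sum>e\<in>s. \<Sum>i\<in>V. count (g e) i)"
  unfolding degree_in_def by (rule sum.swap)

text \<open>
  Such a graph is 2-regular, a disjoint union of cycles. A non-zero summand belongs to a set \<open>s\<close> in
  which all degrees are 0 or 2; by counting ends, exactly \<open>|s|\<close> vertices have degree 2, and their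
  factors \<open>-1\<close> cancel the sign of \<open>(-X)\<^bsup>|s|\<^esup>\<close>.
\<close>

lemma nonneg_coeffs_min_degree_two:
  assumes "finite V" "finite E" "card E = card V"
    and "\<And>e. e \<in> E \<Longrightarrow> size (g e) = 2"
    and "\<And>i. i \<in> V \<Longrightarrow> degree_in g E i \<ge> 2"
  shows "nonneg_coeffs (signed_degree_sum V E g)"
proof -
  have le2: "(\<Sum>i\<in>V. count (g e) i) \<le> 2" if "e \<in> E" for e
    using sum_count_le_size[OF assms(1), of "g e"] assms(4)[OF that] by simp
  \<comment> \<open>Every vertex carries at least two edge ends and every edge has at most two ends in \<open>V\<close>. With as
    many edges as vertices, both bounds are attained everywhere.\<close>
  have "2 * card V \<le> (\<Sum>i\<in>V. degree_in g E i)"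
    using sum_mono[of V "\<lambda>_. 2" "degree_in g E"] assms(5) by (simp add: mult.commute)
  moreover have "(\<Sum>i\<in>V. degree_in g E i) \<le> 2 * card E"
    using sum_mono[of E "\<lambda>e. \<Sum>i\<in>V. count (g e) i" "\<lambda>_. 2"] le2
    unfolding sum_degree_in by (simp add: mult.commute)
  ultimately have total: "(\<Sum>i\<in>V. degree_in g E i) = 2 * card V" "2 * card V = 2 * card E"
    using assms(3) by auto
  have edge2: "(\<Sum>i\<in>V. count (g e) i) = 2" if "e \<in> E" for e
    using sum_eq_bound_imp_eq[of E "\<lambda>e. \<Sum>i\<in>V. count (g e) i" "\<lambda>_. 2" e]
      assms(2) le2 that total unfolding sum_degree_in by auto
  have deg2: "degree_in g E i = 2" if "i \<in> V" for i
    using sum_eq_bound_imp_eq[of V "\<lambda>_. 2" "degree_in g E" i] assms(1,5) that total by simp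
  show ?thesis unfolding signed_degree_sum_def
  proof (rule nonneg_coeffs_sum)
    fix s assume s: "s \<in> Pow E"
    let ?t = "(- [:0, 1:]) ^ card s * (\<Prod>i\<in>V. of_int (1 - int (degree_in g s i))) :: int poly"
    have dle: "degree_in g s i \<le> 2" if "i \<in> V" for i
      unfolding deg2[OF that, symmetric] degree_in_def
      using s assms(2) by (intro sum_mono2) auto
    show "nonneg_coeffs ?t"
    proof (cases "\<exists>i\<in>V. degree_in g s i = 1")
      case True
      then have "(\<Prod>i\<in>V. of_int (1 - int (degree_in g s i)) :: int poly) = 0"
        using assms(1) by (intro prod_zero) auto
      then have "?t = of_nat 0" by simp
      then show ?thesis using nonneg_coeffs_of_nat[of 0] by simp
    next
      case False
      have d02: "degree_in g s i = 0 \<or> degree_in g s i = 2" if "i \<in> V" for i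
        using False dle[OF that] that by (metis One_nat_def le_neq_implies_less less_2_cases)
      define D where "D = {i \<in> V. degree_in g s i = 2}"
      have "(\<Sum>i\<in>V. degree_in g s i) = (\<Sum>i\<in>V. if i \<in> D then 2 else 0)"
        by (rule sum.cong) (use d02 in \<open>auto simp: D_def\<close>)
      also have "\<dots> = 2 * card D"
        using assms(1) by (simp add: sum.If_cases D_def Int_def mult.commute)
      finally have "2 * card D = (\<Sum>i\<in>V. degree_in g s i)" ..
      also have "\<dots> = 2 * card s"
        unfolding sum_degree_in using edge2 s by (simp add: subset_iff)
      finally have cD: "card D = card s" by simp
      have "(\<Prod>i\<in>V. of_int (1 - int (degree_in g s i)) :: int poly) = (\<Prod>i\<in>V. if i \<in> D then -1 else 1)"
        by (rule prod.cong) (use d02 in \<open>auto simp: D_def\<close>)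
      also have "\<dots> = (-1) ^ card s"
        using assms(1) cD by (simp add: prod.If_cases D_def Int_def)
      finally have "?t = (- [:0, 1:] * (-1)) ^ card s"
        by (simp only: power_mult_distrib)
      also have "\<dots> = [:0, 1:] ^ card s" by simp
      finally show ?thesis using nonneg_coeffs_power[OF nonneg_coeffs_X] by simp
    qed
  qed
qed

text \<open>
  Every recursion step leaves \<open>card E - card V\<close> unchanged or lowers it by 1, and in the latter case it
  supplies a factor \<open>1 - X\<close>. Subtraction does not truncate, since the representatives force
  \<open>card V \<le> card E\<close>.
\<close>

theorem signed_degree_sum_nonneg:
  assumes "finite V" "finite E" "\<And>e. e \<in> E \<Longrightarrow> size (g e) = 2"
    and "edge_representatives V E g \<psi>"
  shows "\<exists>p. nonneg_coeffs p \<and> signed_degree_sum V E g = [:1, -1:] ^ (card E - card V) * p"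
  using assms
proof (induction "card E" arbitrary: V E g)
  case 0
  then have "E = {}" by simp
  moreover from this 0 have "V = {}" by (auto simp: edge_representatives_def)
  ultimately have "signed_degree_sum V E g = [:1, -1:] ^ (card E - card V) * of_nat 1"
    by (simp add: signed_degree_sum_def)
  then show ?case using nonneg_coeffs_of_nat by blast
next
  case (Suc n)
  note IH = Suc.hyps(1) and fV = Suc.prems(1) and fE = Suc.prems(2) and sz = Suc.prems(3)
    and rep = Suc.prems(4)
  show ?case
  proof (cases "\<psi> ` V = E")
    case False
    then obtain e where e: "e \<in> E" "e \<notin> \<psi> ` V"
      using rep by (auto simp: edge_representatives_def)
    \<comment> \<open>As \<open>e\<close> is not selected by \<open>\<psi>\<close>, it may be deleted or contracted, and its only vertex may be
      dropped: \<open>\<psi>\<close> still selects distinct edges for the vertices that remain.\<close>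
    define F where "F = E - {e}"
    have F: "E = insert e F" "e \<notin> F" "finite F" "n = card F" "\<And>f. f \<in> F \<Longrightarrow> size (g f) = 2"
      using e Suc.hyps(2) fE sz by (auto simp: F_def card_Diff_singleton_if)
    have repF: "edge_representatives V F g \<psi>"
      using rep e by (auto simp: edge_representatives_def F_def)
    have VF: "card V \<le> card F" using edge_representatives_card_le[OF repF F(3)] .
    have cE: "card E - card V = Suc (card F - card V)" using F VF by simp
    obtain p where p: "nonneg_coeffs p" "signed_degree_sum V F g = [:1, -1:] ^ (card F - card V) * p"
      using IH[OF F(4) fV F(3,5) repF] by blast
    have cVv: "card F - card (V - {v}) = card E - card V" if "v \<in> V" for v
      using that fV VF cE by (cases "card V") (auto simp: card_Diff_singleton_if)
    have repFv: "edge_representatives (V - {v}) F g \<psi>" for v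
      using repF by (auto simp: edge_representatives_def inj_on_def)
    consider (disjoint) "\<And>i. i \<in> V \<Longrightarrow> i \<notin># g e"
      | (single) v where "v \<in> V" "\<And>i. i \<in> V - {v} \<Longrightarrow> i \<notin># g e"
      | (link) u v where "u \<in> V" "v \<in> V" "u \<noteq> v" "g e = {#u, v#}"
    proof -
      have size_e: "size (g e) = 2" using sz e by simp
      then obtain a M where aM: "g e = add_mset a M" by (cases "g e") auto
      then have "size M = 1" using size_e by simp
      then obtain b where "g e = {#a, b#}" using aM size_1_singleton_mset by blast
      then show ?thesis
        using that by (cases "a \<in> V"; cases "b \<in> V"; cases "a = b") auto
    qed
    then show ?thesis
    proof cases
      case disjoint
      then have "signed_degree_sum V E g = [:1, -1:] ^ (card E - card V) * p"
        unfolding cE by (simp only: F(1) p(2) power_Suc mult.assoc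
            signed_degree_sum_insert_disjoint[where g = g, OF F(3,2) disjoint])
      then show ?thesis using p(1) by blast
    next
      case (single v)
      obtain q where q: "nonneg_coeffs q"
          "signed_degree_sum (V - {v}) F g = [:1, -1:] ^ (card F - card (V - {v})) * q"
        using IH[OF F(4) _ F(3,5) repFv, of v] fV by blast
      have "signed_degree_sum V E g =
        [:1, -1:] * ([:1, -1:] ^ (card F - card V) * p)
        + of_nat (count (g e) v) * [:0, 1:] * ([:1, -1:] ^ (card E - card V) * q)"
        by (simp only: F(1) p(2) q(2) cVv[OF single(1)]
            signed_degree_sum_insert_single[where g = g, OF F(3,2) fV single])
      also have "\<dots> = [:1, -1:] ^ (card E - card V) * (p + of_nat (count (g e) v) * [:0, 1:] * q)"
        unfolding cE power_Suc by (simp only: algebra_simps)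
      finally have "signed_degree_sum V E g =
        [:1, -1:] ^ (card E - card V) * (p + of_nat (count (g e) v) * [:0, 1:] * q)" .
      moreover have "nonneg_coeffs (p + of_nat (count (g e) v) * [:0, 1:] * q)"
        by (intro nonneg_coeffs_add nonneg_coeffs_mult nonneg_coeffs_X nonneg_coeffs_of_nat p(1) q(1))
      ultimately show ?thesis by blast
    next
      case (link u v)
      let ?h = "contract_ends u v g"
      have rep': "edge_representatives (V - {v}) F ?h \<psi>"
        unfolding edge_representatives_def
      proof (intro conjI ballI)
        fix i assume i: "i \<in> V - {v}"
        then have "i \<in># g (\<psi> i)" using repF by (auto simp: edge_representatives_def)
        then show "i \<in># ?h (\<psi> i)" using i by (force simp: contract_ends_def)
      qed (use repFv in \<open>auto simp: edge_representatives_def\<close>)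
      obtain q where q: "nonneg_coeffs q"
          "signed_degree_sum (V - {v}) F ?h = [:1, -1:] ^ (card F - card (V - {v})) * q"
        using IH[OF F(4) _ F(3) _ rep'] fV F(5) by (auto simp: contract_ends_def)
      have "signed_degree_sum V E g =
        [:1, -1:] * ([:1, -1:] ^ (card F - card V) * p)
        + [:0, 1:] * ([:1, -1:] ^ (card E - card V) * q)"
        by (simp only: F(1) p(2) q(2) cVv[OF link(2)]
            signed_degree_sum_deletion_contraction[where g = g, OF F(3,2) fV link])
      also have "\<dots> = [:1, -1:] ^ (card E - card V) * (p + [:0, 1:] * q)"
        unfolding cE power_Suc by (simp only: algebra_simps)
      finally have "signed_degree_sum V E g =
        [:1, -1:] ^ (card E - card V) * (p + [:0, 1:] * q)" .
      moreover have "nonneg_coeffs (p + [:0, 1:] * q)"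
        by (intro nonneg_coeffs_add nonneg_coeffs_mult nonneg_coeffs_X p(1) q(1))
      ultimately show ?thesis by blast
    qed
  next
    case True
    then have cEV: "card E = card V"
      using rep by (auto simp: edge_representatives_def card_image)
    have pos: "count (g (\<psi> i)) i \<ge> 1" if "i \<in> V" for i
      using rep that by (auto simp: edge_representatives_def Suc_le_eq)
    have split: "degree_in g E i = count (g (\<psi> i)) i + degree_in g (E - {\<psi> i}) i" if "i \<in> V" for i
      unfolding degree_in_def using True that fE by (intro sum.remove) auto
    show ?thesis
    proof (cases "\<exists>v\<in>V. degree_in g E v = 1")
      case True
      then obtain v where v: "v \<in> V" "degree_in g E v = 1" by blast
      define F where "F = E - {\<psi> v}"
      have \<psi>v: "\<psi> v \<in> E" using rep v by (auto simp: edge_representatives_def)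
      then have F: "E = insert (\<psi> v) F" "\<psi> v \<notin> F" "finite F" "n = card F"
          "\<And>f. f \<in> F \<Longrightarrow> size (g f) = 2"
        using Suc.hyps(2) fE sz by (auto simp: F_def card_Diff_singleton_if)
      have c: "count (g (\<psi> v)) v = 1" "degree_in g F v = 0"
        using pos[OF v(1)] split[OF v(1)] v(2) unfolding F_def by linarith+
      have rep': "edge_representatives (V - {v}) F g \<psi>"
        using rep v(1) by (auto simp: edge_representatives_def F_def inj_on_def)
      have "card F - card (V - {v}) = card E - card V"
        using v(1) F fV cEV Suc.hyps(2) by (simp add: card_Diff_singleton_if)
      then show ?thesis
        using IH[OF F(4) _ F(3,5) rep'] signed_degree_sum_leaf[OF F(3,2) fV v(1) c] F(1) fV by auto
    next
      case False
      have "degree_in g E i \<ge> 2" if "i \<in> V" for i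
      proof -
        have "degree_in g E i \<ge> 1" using pos[OF that] split[OF that] by linarith
        moreover have "degree_in g E i \<noteq> 1" using False that by blast
        ultimately show ?thesis by simp
      qed
      then have "nonneg_coeffs (signed_degree_sum V E g)"
        using nonneg_coeffs_min_degree_two[where g = g, OF fV fE cEV sz] by blast
      then show ?thesis using cEV by auto
    qed
  qed
qed

section \<open>Distinct edge representatives from positive nullity\<close>

definition edge_rel :: "'e set \<Rightarrow> ('e \<Rightarrow> 'v multiset) \<Rightarrow> ('v \<times> 'v) set" where
  "edge_rel F g = {(u, v). \<exists>e\<in>F. g e = {#u, v#}}"

lemma sym_edge_rel: "sym (edge_rel F g)"
proof (rule symI)
  fix u v assume "(u, v) \<in> edge_rel F g"
  then obtain e where e: "e \<in> F" "g e = {#u, v#}" by (auto simp: edge_rel_def)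
  then have "g e = {#v, u#}" by (metis add_mset_commute)
  with e(1) show "(v, u) \<in> edge_rel F g" by (auto simp: edge_rel_def)
qed

lemma rtrancl_edge_rel_sym: "(u, v) \<in> (edge_rel F g)\<^sup>* \<Longrightarrow> (v, u) \<in> (edge_rel F g)\<^sup>*"
  by (rule symD[OF sym_rtrancl[OF sym_edge_rel]])

text \<open>
  The breadth-first tree from \<open>r\<close>: every other vertex selects an edge to a vertex strictly closer to
  \<open>r\<close>. Two vertices selecting the same edge would each be closer than the other.
\<close>

lemma spanning_tree_representatives:
  assumes C: "C = (edge_rel F g)\<^sup>* `` {r}"
  obtains \<psi> where "inj_on \<psi> (C - {r})" "\<psi> ` (C - {r}) \<subseteq> F"
    "\<And>v. v \<in> C - {r} \<Longrightarrow> v \<in># g (\<psi> v) \<and> set_mset (g (\<psi> v)) \<subseteq> C"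
    "C \<subseteq> (edge_rel (\<psi> ` (C - {r})) g)\<^sup>* `` {r}"
proof -
  define R where "R = edge_rel F g"
  define d where "d v = (LEAST n. (r, v) \<in> R ^^ n)" for v
  have d: "(r, v) \<in> R ^^ d v" if "v \<in> C" for v
  proof -
    have "(r, v) \<in> R\<^sup>*" using that by (simp add: C R_def)
    then obtain n where "(r, v) \<in> R ^^ n" using rtrancl_imp_relpow by blast
    then show ?thesis unfolding d_def by (rule LeastI)
  qed
  have "\<exists>e w. e \<in> F \<and> g e = {#w, v#} \<and> w \<in> C \<and> d w < d v" if v: "v \<in> C - {r}" for v
  proof -
    have "d v \<noteq> 0"
    proof
      assume "d v = 0"
      then have "(r, v) \<in> R ^^ 0" using d[of v] v by (metis DiffD1)
      then show False using v by simp
    qed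
    then obtain n where n: "d v = Suc n" by (cases "d v") auto
    then have "(r, v) \<in> R ^^ Suc n" using d[of v] v by simp
    then obtain w where w: "(r, w) \<in> R ^^ n" "(w, v) \<in> R" by auto
    have "d w \<le> n" unfolding d_def using w(1) by (rule Least_le)
    moreover have "w \<in> C" using w(1) unfolding C R_def[symmetric] by (auto simp: rtrancl_power)
    ultimately show ?thesis using w(2) n by (auto simp: R_def edge_rel_def)
  qed
  then obtain \<psi> w where \<psi>: "\<And>v. v \<in> C - {r} \<Longrightarrow>
      \<psi> v \<in> F \<and> g (\<psi> v) = {#w v, v#} \<and> w v \<in> C \<and> d (w v) < d v"
    by metis
  have closer: "d (w v) < d v" if "v \<in> C - {r}" for v using \<psi>[OF that] by simp
  let ?T = "\<psi> ` (C - {r})"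
  have "inj_on \<psi> (C - {r})"
  proof (rule inj_onI, rule ccontr)
    fix x y assume xy: "x \<in> C - {r}" "y \<in> C - {r}" "\<psi> x = \<psi> y" "x \<noteq> y"
    then have "{#w x, x#} = {#w y, y#}" using \<psi> by metis
    then have "set_mset {#w x, x#} = set_mset {#w y, y#}" by (rule arg_cong)
    then have "{w x, x} = {w y, y}" by simp
    then have "w x = y \<and> w y = x" using xy(4) by (metis doubleton_eq_iff)
    then show False using closer[OF xy(1)] closer[OF xy(2)] by simp
  qed
  moreover have "(r, v) \<in> (edge_rel ?T g)\<^sup>*" if "v \<in> C" for v
    using that
  proof (induction "d v" arbitrary: v rule: less_induct)
    case less
    show ?case
    proof (cases "v = r")
      case False
      then have v: "v \<in> C - {r}" using less by simp
      then have "(r, w v) \<in> (edge_rel ?T g)\<^sup>*" using \<psi> less.hyps by blast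
      moreover have "(w v, v) \<in> edge_rel ?T g" using \<psi> v by (auto simp: edge_rel_def)
      ultimately show ?thesis by simp
    qed simp
  qed
  ultimately show ?thesis using \<psi> by (intro that[of \<psi>]) auto
qed

text \<open>
  The tree from \<open>r\<close> uses one edge less than there are vertices, so a nullity other than 0 leaves an
  edge \<open>e\<close> of the component outside this tree. The tree is then traversed again from an end \<open>a\<close> of
  \<open>e\<close>. Since the second traversal only uses edges of the tree, \<open>e\<close> is free to represent \<open>a\<close>.
\<close>

lemma component_representatives:
  assumes C: "C = (edge_rel E g)\<^sup>* `` {r}" and "finite C" "finite E"
    and "\<And>e. e \<in> E \<Longrightarrow> size (g e) = 2"
    and null: "card {e \<in> E. set_mset (g e) \<subseteq> C} + 1 \<noteq> card C"
  shows "\<exists>\<psi>. edge_representatives C {e \<in> E. set_mset (g e) \<subseteq> C} g \<psi>"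
proof -
  let ?E = "{e \<in> E. set_mset (g e) \<subseteq> C}"
  have r: "r \<in> C" using C by simp
  obtain \<phi> where \<phi>: "inj_on \<phi> (C - {r})" "\<phi> ` (C - {r}) \<subseteq> E"
    "\<And>v. v \<in> C - {r} \<Longrightarrow> v \<in># g (\<phi> v) \<and> set_mset (g (\<phi> v)) \<subseteq> C"
    "C \<subseteq> (edge_rel (\<phi> ` (C - {r})) g)\<^sup>* `` {r}"
    using spanning_tree_representatives[OF C] by blast
  define T where "T = \<phi> ` (C - {r})"
  have T: "T \<subseteq> ?E" using \<phi> by (auto simp: T_def)
  have "card T = card C - 1" unfolding T_def using \<phi>(1) r assms(2) by (simp add: card_image)
  moreover have "card C > 0" using r assms(2) card_gt_0_iff by blast
  ultimately have "T \<noteq> ?E" using null by auto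
  then obtain e where e: "e \<in> ?E" "e \<notin> T" using T by blast
  have "g e \<noteq> {#}" using assms(4) e by force
  then obtain a where a: "a \<in># g e" by blast
  then have aC: "a \<in> C" using e by auto
  have reach: "(r, v) \<in> (edge_rel T g)\<^sup>*" if "v \<in> C" for v
    using subsetD[OF \<phi>(4) that] by (simp add: T_def)
  define D where "D = (edge_rel T g)\<^sup>* `` {a}"
  have CD: "C \<subseteq> D"
  proof
    fix v assume "v \<in> C"
    then have "(a, v) \<in> (edge_rel T g)\<^sup>*"
      using rtrancl_trans[OF rtrancl_edge_rel_sym[OF reach[OF aC]] reach] by blast
    then show "v \<in> D" by (simp add: D_def)
  qed
  obtain \<chi> where \<chi>: "inj_on \<chi> (D - {a})" "\<chi> ` (D - {a}) \<subseteq> T"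
    "\<And>v. v \<in> D - {a} \<Longrightarrow> v \<in># g (\<chi> v) \<and> set_mset (g (\<chi> v)) \<subseteq> D"
    by (rule spanning_tree_representatives[OF D_def]) (rule that)
  have "inj_on (\<chi>(a := e)) C"
  proof (rule inj_onI)
    fix x y assume xy: "x \<in> C" "y \<in> C" "(\<chi>(a := e)) x = (\<chi>(a := e)) y"
    have other: "\<chi> z \<noteq> e \<and> z \<in> D - {a}" if "z \<in> C" "z \<noteq> a" for z
      using that CD \<chi>(2) e(2) by blast
    show "x = y"
    proof (cases "x = a \<or> y = a")
      case True
      then show ?thesis using xy other[of x] other[of y] by (metis fun_upd_apply)
    next
      case False
      then show ?thesis using xy other[of x] other[of y] inj_onD[OF \<chi>(1)] by (metis fun_upd_apply)
    qed
  qed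
  moreover have "(\<chi>(a := e)) ` C \<subseteq> ?E"
  proof (rule image_subsetI)
    fix z assume "z \<in> C"
    then show "(\<chi>(a := e)) z \<in> ?E"
      using CD \<chi>(2) T e(1) by (cases "z = a") (simp, unfold fun_upd_apply, auto)
  qed
  moreover have "\<forall>v\<in>C. v \<in># g ((\<chi>(a := e)) v)" using CD \<chi>(3) a by auto
  ultimately show ?thesis unfolding edge_representatives_def by blast
qed

text \<open>
  The selections in the components can be combined, because an edge selected by two vertices lies in
  the components of both.
\<close>

lemma (in finite_multigraph) representatives_of_nullity:
  assumes "\<forall>H\<in>connected_components G. nullity H \<noteq> 0"
  shows "\<exists>\<psi>. edge_representatives (verts G) (edges G) (ends G) \<psi>"
proof -
  define R where "R = edge_rel (edges G) (ends G)"
  have adj: "adj G = R" by (simp add: adj_def R_def edge_rel_def)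
  define K where "K v = R\<^sup>* `` {v}" for v
  have RV: "y \<in> verts G" if "(x, y) \<in> R" for x y
    using that ends_in_verts unfolding R_def edge_rel_def by fastforce
  have KV: "K v \<subseteq> verts G" if v: "v \<in> verts G" for v
  proof
    fix w assume "w \<in> K v"
    then have "(v, w) \<in> R\<^sup>*" by (simp add: K_def)
    then show "w \<in> verts G" by (induction) (use v RV in auto)
  qed
  have rep: "\<exists>\<psi>. edge_representatives (K v) {e \<in> edges G. set_mset (ends G e) \<subseteq> K v} (ends G) \<psi>"
    if v: "v \<in> verts G" for v
  proof (rule component_representatives)
    show "K v = (edge_rel (edges G) (ends G))\<^sup>* `` {v}" by (simp add: K_def R_def)
    show "finite (K v)" using KV[OF v] finite_verts finite_subset by blast
    have "Restr (R\<^sup>*) (verts G) `` {v} = K v" using KV[OF v] v by (auto simp: K_def)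
    then have "K v \<in> verts G // Restr ((adj G)\<^sup>*) (verts G)"
      unfolding adj using v by (auto simp: quotient_def)
    then have "nullity (induced_subgraph G (K v)) \<noteq> 0"
      using assms by (auto simp: connected_components_def)
    then show "card {e \<in> edges G. set_mset (ends G e) \<subseteq> K v} + 1 \<noteq> card (K v)"
      by (auto simp: nullity_def induced_subgraph_def)
  qed (use finite_edges size_ends in auto)
  \<comment> \<open>The selection has to depend on the component only, not on a vertex naming it: otherwise two
    vertices of the same component could be given the same edge.\<close>
  define \<Psi> where
    "\<Psi> C = (SOME \<psi>. edge_representatives C {e \<in> edges G. set_mset (ends G e) \<subseteq> C} (ends G) \<psi>)" for C
  have \<Psi>: "edge_representatives (K v) {e \<in> edges G. set_mset (ends G e) \<subseteq> K v} (ends G) (\<Psi> (K v))"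
    if "v \<in> verts G" for v
    unfolding \<Psi>_def using someI_ex[OF rep[OF that]] .
  have self: "v \<in> K v" for v by (simp add: K_def)
  have Keq: "K w = K v" if "w \<in> K v" for v w
  proof -
    have vw: "(v, w) \<in> R\<^sup>*" using that by (simp add: K_def)
    then have "(w, v) \<in> R\<^sup>*" unfolding R_def by (rule rtrancl_edge_rel_sym)
    with vw have "(w, x) \<in> R\<^sup>* \<longleftrightarrow> (v, x) \<in> R\<^sup>*" for x
      using rtrancl_trans[of v w R x] rtrancl_trans[of w v R x] by blast
    then show ?thesis by (simp add: K_def Image_def)
  qed
  have ends_own: "\<Psi> (K v) v \<in> edges G" "set_mset (ends G (\<Psi> (K v) v)) \<subseteq> K v" "v \<in># ends G (\<Psi> (K v) v)"
    if "v \<in> verts G" for v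
    using \<Psi>[OF that] self[of v] by (auto simp: edge_representatives_def)
  have "inj_on (\<lambda>v. \<Psi> (K v) v) (verts G)"
  proof (rule inj_onI)
    fix x y assume xy: "x \<in> verts G" "y \<in> verts G" "\<Psi> (K x) x = \<Psi> (K y) y"
    then have "y \<in> K x" using ends_own(2)[OF xy(1)] ends_own(3)[OF xy(2)] by auto
    then have "K y = K x" by (rule Keq)
    then show "x = y"
      using xy(3) \<Psi>[OF xy(1)] self[of x] self[of y]
      by (auto simp: edge_representatives_def dest: inj_onD)
  qed
  then show ?thesis
    using ends_own by (intro exI[of _ "\<lambda>v. \<Psi> (K v) v"]) (auto simp: edge_representatives_def)
qed

section \<open>The specialisation at twice the imaginary unit\<close>

text \<open>
  The recursion at \<open>2\<i>\<close> has the characteristic polynomial \<open>x\<^sup>2 - 2\<i>x - 1 = (x - \<i>)\<^sup>2\<close>, so the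
  solutions are \<open>(A + B n) \<i>\<^sup>n\<close>.
\<close>

lemma poly_f_poly: "poly (f_poly n) (2 * \<i>) = of_int (1 - int n) * \<i> ^ n"
proof (induction n rule: f_poly.induct)
  case (3 n)
  have ii: "\<i> * \<i> = - 1" by simp
  have step: "2 * \<i> * (- c * (\<i> * z)) + (1 - c) * z = (- 1 - c) * (\<i> * (\<i> * z))" for c z
    using ii by algebra
  have "poly (f_poly (Suc (Suc n))) (2 * \<i>) =
      2 * \<i> * (- of_nat n * (\<i> * \<i> ^ n)) + (1 - of_nat n) * \<i> ^ n"
    using 3 by simp
  also have "\<dots> = of_int (1 - int (Suc (Suc n))) * \<i> ^ Suc (Suc n)"
    unfolding step by simp
  finally show ?case .
qed simp_all

lemma map_poly_of_int_hom:
  "map_poly (of_int :: int \<Rightarrow> complex) (p + q) = map_poly of_int p + map_poly of_int q"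
  "map_poly (of_int :: int \<Rightarrow> complex) (p * q) = map_poly of_int p * map_poly of_int q"
  "map_poly (of_int :: int \<Rightarrow> complex) (p ^ n) = map_poly of_int p ^ n"
  "map_poly (of_int :: int \<Rightarrow> complex) (sum f A) = (\<Sum>x\<in>A. map_poly of_int (f x))"
proof -
  show add: "map_poly (of_int :: int \<Rightarrow> complex) (p + q) = map_poly of_int p + map_poly of_int q" for p q
    by (rule poly_eqI) (simp add: coeff_map_poly)
  show mult: "map_poly (of_int :: int \<Rightarrow> complex) (p * q) = map_poly of_int p * map_poly of_int q" for p q
    by (rule poly_eqI) (simp add: coeff_map_poly coeff_mult)
  show "map_poly (of_int :: int \<Rightarrow> complex) (p ^ n) = map_poly of_int p ^ n"
    by (induction n) (simp_all add: mult)
  show "map_poly (of_int :: int \<Rightarrow> complex) (sum f A) = (\<Sum>x\<in>A. map_poly of_int (f x))"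
    by (induction A rule: infinite_finite_induct) (simp_all add: add)
qed

text \<open>
  Here the ends of every edge must lie in the vertex set: only then do the degrees in \<open>s\<close> sum to
  \<open>2|s|\<close> and the powers of \<open>\<i>\<close> combine to the sign \<open>(-1)\<^bsup>|s|\<^esup>\<close>.
\<close>

lemma (in finite_multigraph) theta_eq_signed_degree_sum:
  "theta G (2 * \<i>) = map_poly of_int (signed_degree_sum (verts G) (edges G) (ends G))"
  unfolding theta_def signed_degree_sum_def map_poly_of_int_hom(4)
proof (rule sum.cong[OF refl])
  fix s assume s: "s \<in> Pow (edges G)"
  let ?d = "degree_in (ends G) s"
  have deg: "vertex_degree (spanning_subgraph G s) i = ?d i" for i
    by (simp add: vertex_degree_def spanning_subgraph_def degree_in_def)
  have "(\<Sum>i\<in>verts G. count (ends G e) i) = 2" if "e \<in> edges G" for e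
  proof -
    have "(\<Sum>i\<in>verts G. count (ends G e) i) = (\<Sum>i\<in>set_mset (ends G e). count (ends G e) i)"
      using finite_verts ends_in_verts[OF that] by (intro sum.mono_neutral_right) (auto simp: not_in_iff)
    then show ?thesis using size_ends[OF that] by (simp add: size_multiset_overloaded_eq)
  qed
  then have "(\<Sum>i\<in>verts G. ?d i) = 2 * card s"
    unfolding sum_degree_in using s by (simp add: subset_iff)
  then have "(\<Prod>i\<in>verts G. \<i> ^ ?d i) = (-1) ^ card s"
    by (simp add: power_sum[symmetric] power_mult)
  then have "(\<Prod>i\<in>verts G. poly (f_poly (?d i)) (2 * \<i>)) =
      of_int ((-1) ^ card s * (\<Prod>i\<in>verts G. 1 - int (?d i)))"
    by (simp add: poly_f_poly prod.distrib)
  moreover have "(- [:0, 1:]) ^ card s * (\<Prod>i\<in>verts G. of_int (1 - int (?d i))) =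
      monom ((-1) ^ card s * (\<Prod>i\<in>verts G. 1 - int (?d i))) (card s)"
  proof -
    have "(- [:0, 1:]) ^ card s = monom ((-1) ^ card s :: int) (card s)"
    proof -
      have "- [:0, 1:] = monom (-1 :: int) 1" by (simp add: monom_Suc monom_0)
      then show ?thesis by (simp only: monom_power mult_1)
    qed
    moreover have "(\<Prod>i\<in>verts G. of_int (1 - int (?d i))) = monom (\<Prod>i\<in>verts G. 1 - int (?d i)) 0"
      by (subst of_int_prod[symmetric]) (simp only: of_int_poly of_int_eq_id id_apply monom_0)
    ultimately show ?thesis by (simp only: mult_monom) simp
  qed
  ultimately show "monom (\<Prod>i\<in>verts G. poly (f_poly (vertex_degree (spanning_subgraph G s) i)) (2 * \<i>))
      (card s) = map_poly of_int ((- [:0, 1:]) ^ card s * (\<Prod>i\<in>verts G. of_int (1 - int (?d i))))"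
    by (simp only: deg map_poly_monom of_int_0)
qed

theorem proposition4:
  fixes G :: "('v, 'e) multigraph"
  assumes "finite_multigraph G"
    and "\<forall>H\<in>connected_components G. nullity H \<noteq> 0"
  shows "\<exists>p :: int poly. omega G = to_fract (map_poly of_int p) \<and> (\<forall>k. coeff p k \<ge> 0)"
proof -
  interpret finite_multigraph G by fact
  obtain \<psi> where \<psi>: "edge_representatives (verts G) (edges G) (ends G) \<psi>"
    using representatives_of_nullity[OF assms(2)] by blast
  let ?n = "card (edges G) - card (verts G)"
  have le: "card (verts G) \<le> card (edges G)"
    using edge_representatives_card_le[OF \<psi> finite_edges] .
  obtain p where p: "nonneg_coeffs p"
      "signed_degree_sum (verts G) (edges G) (ends G) = [:1, -1:] ^ ?n * p"
    using signed_degree_sum_nonneg[OF finite_verts finite_edges size_ends \<psi>] by blast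
  have lin: "map_poly (of_int :: int \<Rightarrow> complex) [:1, -1:] = [:1, -1:]"
    by (simp add: map_poly_pCons)
  have "theta G (2 * \<i>) = [:1, -1:] ^ ?n * map_poly of_int p"
    unfolding theta_eq_signed_degree_sum p(2) map_poly_of_int_hom lin ..
  moreover have "to_fract ([:1, -1:] :: complex poly) powi (int (card (edges G)) - int (card (verts G)))
      = to_fract ([:1, -1:] ^ ?n)"
  proof -
    have "to_fract (q ^ n) = to_fract q ^ n" for q :: "complex poly" and n
      by (induction n) simp_all
    moreover have "int (card (edges G)) - int (card (verts G)) = int ?n" using le by simp
    ultimately show ?thesis by (simp only: power_int_of_nat)
  qed
  moreover have "([:1, -1:] :: complex poly) ^ ?n \<noteq> 0" by simp
  ultimately have "omega G = to_fract (map_poly of_int p)"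
    unfolding omega_def by simp
  then show ?thesis using p(1) unfolding nonneg_coeffs_def by blast
qed

end
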